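(* Let $E:\mathbb{R}^n\to\mathbb{R}^n$ and $\Psi:\mathbb{R}^n\times\mathbb{R}^n\to\mathbb{R}^n$ be maps, and consider the problem (P): minimize $h(s)$ subject to $h_j(s)\le 0$, $1\le j\le k$, $s\in\mathbb{R}^n$, where $h,h_1,\dots,h_k:\mathbb{R}^n\to\mathbb{R}$ are either all SSEP w.r.t. $\Psi$ on $\mathbb{R}^n$ or all SQSEP w.r.t. $\Psi$ on $\mathbb{R}^n$. Let $X=\{s\in\mathbb{R}^n: h_j(s)\le 0,\ 1\le j\le k\}$ be the feasible set, and let $X$ be an SEI set w.r.t. $\Psi$. Suppose $h$ is SSEP w.r.t. $\Psi$ on $X$, and that $\beta=\min_{s\in X}h(s)$ (the minimum being attained). Then the set $X_{opt}=\{s\in X:h(s)=\beta\}$ of optimal solutions of (P) is an SEI set w.r.t. $\Psi$. If moreover $h$ is SSSEP w.r.t. $\Psi$ on $X$, then $X_{opt}$ is a singleton.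
   Context: Write $Es$ for $E(s)$. A set $S\subseteq\mathbb{R}^n$ is strongly $E$-invex (SEI) w.r.t. $\Psi$ if $\alpha t+Et+\lambda\Psi(\alpha s+Es,\alpha t+Et)\in S$ for all $s,t\in S$, $\alpha\in[0,1]$, $\lambda\in[0,1]$. Let $S$ be an SEI set w.r.t. $\Psi$ and $h$ a real-valued function defined on a set containing $S$. - $h$ is semi strongly $E$-preinvex (SSEP) w.r.t. $\Psi$ on $S$ if $h(\alpha t+Et+\lambda\Psi(\alpha s+Es,\alpha t+Et))\le\lambda h(s)+(1-\lambda)h(t)$ for all $s,t\in S$, $\alpha,\lambda\in[0,1]$. - $h$ is semi quasi strongly $E$-preinvex (SQSEP) w.r.t. $\Psi$ on $S$ if $h(\alpha t+Et+\lambda\Psi(\alpha s+Es,\alpha t+Et))\le\max\{h(s),h(t)\}$ for all $s,t\in S$, $\alpha,\lambda\in[0,1]$. - $h$ is strictly semi strongly $E$-preinvex (SSSEP) w.r.t. $\Psi$ on $S$ if $h(\alpha t+Et+\lambda\Psi(\alpha s+Es,\alpha t+Et))<\lambda h(s)+(1-\lambda)h(t)$ for all $s,t\in S$, $\alpha\in[0,1]$, $\lambda\in(0,1)$ with $\alpha s+Es\ne\alpha t+Et$. *)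

theory Defs
  imports "HOL-Analysis.Analysis"
begin

text \<open>SEI: strongly \<open>E\<close>-invex; SSEP, SQSEP, SSSEP: semi, semi quasi and strictly semi strongly
  \<open>E\<close>-preinvex, all with respect to \<open>\<Psi>\<close>.\<close>

definition SEI ::
  "(real^'n \<Rightarrow> real^'n) \<Rightarrow> ((real^'n) \<times> (real^'n) \<Rightarrow> real^'n) \<Rightarrow> (real^'n) set \<Rightarrow> bool" where
  "SEI E \<Psi> S \<longleftrightarrow>
    (\<forall>s\<in>S. \<forall>t\<in>S. \<forall>\<alpha>\<in>{0..1}. \<forall>\<mu>\<in>{0..1}.
      \<alpha> *\<^sub>R t + E t + \<mu> *\<^sub>R \<Psi> (\<alpha> *\<^sub>R s + E s, \<alpha> *\<^sub>R t + E t) \<in> S)"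

text \<open>SSEP, SQSEP and SSSEP are defined only for functions on strongly \<open>E\<close>-invex sets;
  this presupposition is the first conjunct of each definition. Functions are total on \<open>real^'n\<close>,
  and the conditions involve their values on \<open>S\<close> only.\<close>

definition SSEP ::
  "(real^'n \<Rightarrow> real^'n) \<Rightarrow> ((real^'n) \<times> (real^'n) \<Rightarrow> real^'n) \<Rightarrow> (real^'n) set \<Rightarrow>
    (real^'n \<Rightarrow> real) \<Rightarrow> bool" where
  "SSEP E \<Psi> S h \<longleftrightarrow> SEI E \<Psi> S \<and>
    (\<forall>s\<in>S. \<forall>t\<in>S. \<forall>\<alpha>\<in>{0..1}. \<forall>\<mu>\<in>{0..1}.
      h (\<alpha> *\<^sub>R t + E t + \<mu> *\<^sub>R \<Psi> (\<alpha> *\<^sub>R s + E s, \<alpha> *\<^sub>R t + E t))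
        \<le> \<mu> * h s + (1 - \<mu>) * h t)"

definition SQSEP ::
  "(real^'n \<Rightarrow> real^'n) \<Rightarrow> ((real^'n) \<times> (real^'n) \<Rightarrow> real^'n) \<Rightarrow> (real^'n) set \<Rightarrow>
    (real^'n \<Rightarrow> real) \<Rightarrow> bool" where
  "SQSEP E \<Psi> S h \<longleftrightarrow> SEI E \<Psi> S \<and>
    (\<forall>s\<in>S. \<forall>t\<in>S. \<forall>\<alpha>\<in>{0..1}. \<forall>\<mu>\<in>{0..1}.
      h (\<alpha> *\<^sub>R t + E t + \<mu> *\<^sub>R \<Psi> (\<alpha> *\<^sub>R s + E s, \<alpha> *\<^sub>R t + E t))
        \<le> max (h s) (h t))"

definition SSSEP ::
  "(real^'n \<Rightarrow> real^'n) \<Rightarrow> ((real^'n) \<times> (real^'n) \<Rightarrow> real^'n) \<Rightarrow> (real^'n) set \<Rightarrow>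
    (real^'n \<Rightarrow> real) \<Rightarrow> bool" where
  "SSSEP E \<Psi> S h \<longleftrightarrow> SEI E \<Psi> S \<and>
    (\<forall>s\<in>S. \<forall>t\<in>S. \<forall>\<alpha>\<in>{0..1}. \<forall>\<mu>\<in>{0<..<1}.
      \<alpha> *\<^sub>R s + E s \<noteq> \<alpha> *\<^sub>R t + E t \<longrightarrow>
      h (\<alpha> *\<^sub>R t + E t + \<mu> *\<^sub>R \<Psi> (\<alpha> *\<^sub>R s + E s, \<alpha> *\<^sub>R t + E t))
        < \<mu> * h s + (1 - \<mu>) * h t)"

end

theory Submission
  imports Defs
begin

text \<open>For distinct points \<open>s\<close> and \<open>t\<close>, strict preinvexity applies for some \<open>\<alpha>\<close>: if
  \<open>E s = E t\<close> then \<open>\<alpha> = 1\<close> works, otherwise \<open>\<alpha> = 0\<close> does. Two distinct minimizers would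
  then produce a point with a value below the minimum.\<close>

text \<open>Invexity of \<open>X\<close>, the first conjunct of \<open>SSEP\<close>, keeps the new
  point feasible, so its value is at least \<beta>. Preinvexity bounds the same value from above by
  a convex combination of \<beta> with itself, and the two bounds meet.\<close>

lemma SEI_minimizers:
  assumes "SSEP E \<Psi> X h" and "\<forall>s\<in>X. \<beta> \<le> h s"
  shows "SEI E \<Psi> {s\<in>X. h s = \<beta>}"
  unfolding SEI_def
proof (intro ballI)
  fix s t \<alpha> \<mu>
  assume s: "s \<in> {s\<in>X. h s = \<beta>}" and t: "t \<in> {s\<in>X. h s = \<beta>}"
    and \<alpha>: "\<alpha> \<in> {0..1::real}" and \<mu>: "\<mu> \<in> {0..1::real}"
  let ?p = "\<alpha> *\<^sub>R t + E t + \<mu> *\<^sub>R \<Psi> (\<alpha> *\<^sub>R s + E s, \<alpha> *\<^sub>R t + E t)"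
  have "?p \<in> X"
    using assms(1) s t \<alpha> \<mu> unfolding SSEP_def SEI_def by blast
  moreover have "h ?p \<le> \<mu> * h s + (1 - \<mu>) * h t"
    using assms(1) s t \<alpha> \<mu> unfolding SSEP_def by blast
  then have "h ?p \<le> \<beta>"
    using s t by (simp add: algebra_simps)
  ultimately show "?p \<in> {s\<in>X. h s = \<beta>}"
    using assms(2) by force
qed

lemma SSSEP_minimizer_unique:
  assumes "SSSEP E \<Psi> X h" and "\<forall>s\<in>X. \<beta> \<le> h s"
    and "s \<in> X" "h s = \<beta>" "t \<in> X" "h t = \<beta>"
  shows "s = t"
proof (rule ccontr)
  assume "s \<noteq> t"
  define \<alpha> :: real where "\<alpha> = (if E s = E t then 1 else 0)"
  \<comment> \<open>Any weight strictly between 0 and 1 would serve in place of 1/2: as an element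
    of the closed interval it puts \<open>p\<close> in \<open>X\<close>, and as an element of the
    open one it makes the inequality strict.\<close>
  define p where "p = \<alpha> *\<^sub>R t + E t + (1/2) *\<^sub>R \<Psi> (\<alpha> *\<^sub>R s + E s, \<alpha> *\<^sub>R t + E t)"
  have ne: "\<alpha> *\<^sub>R s + E s \<noteq> \<alpha> *\<^sub>R t + E t"
    using \<open>s \<noteq> t\<close> by (simp add: \<alpha>_def)
  have \<alpha>: "\<alpha> \<in> {0..1}"
    by (simp add: \<alpha>_def)
  have half: "1/2 \<in> {0..1::real}" "1/2 \<in> {0<..<1::real}"
    by auto
  have "p \<in> X"
    using assms(1,3,5) \<alpha> half(1) unfolding SSSEP_def SEI_def p_def by blast
  then have "\<beta> \<le> h p"
    using assms(2) by blast
  \<comment> \<open>Both \<open>h s\<close> and \<open>h t\<close> equal \<beta>, so the right-hand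
    side is just \<beta>.\<close>
  have "h p < (1/2) * h s + (1 - 1/2) * h t"
    using assms(1,3,5) \<alpha> half(2) ne unfolding SSSEP_def p_def by blast
  with \<open>\<beta> \<le> h p\<close> assms(4,6) show False
    by simp
qed

theorem theorem23:
  fixes E :: "real^'n \<Rightarrow> real^'n"
    and \<Psi> :: "(real^'n) \<times> (real^'n) \<Rightarrow> real^'n"
    and h :: "real^'n \<Rightarrow> real"
    and g :: "nat \<Rightarrow> real^'n \<Rightarrow> real"
    and k :: nat
    and X X_opt :: "(real^'n) set"
    and \<beta> :: real
  assumes "(SSEP E \<Psi> UNIV h \<and> (\<forall>j\<in>{1..k}. SSEP E \<Psi> UNIV (g j))) \<or>
           (SQSEP E \<Psi> UNIV h \<and> (\<forall>j\<in>{1..k}. SQSEP E \<Psi> UNIV (g j)))"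
    and "X = {s. \<forall>j\<in>{1..k}. g j s \<le> 0}"
    and "SEI E \<Psi> X"
    and "SSEP E \<Psi> X h"
    and "\<exists>s\<in>X. h s = \<beta>" and "\<forall>s\<in>X. \<beta> \<le> h s"
    and "X_opt = {s\<in>X. h s = \<beta>}"
  shows "SEI E \<Psi> X_opt \<and> (SSSEP E \<Psi> X h \<longrightarrow> is_singleton X_opt)"
proof (intro conjI impI)
  show "SEI E \<Psi> X_opt"
    using SEI_minimizers assms(4,6,7) by blast
next
  assume strict: "SSSEP E \<Psi> X h"
  \<comment> \<open>Strictness yields at most one minimizer; that there is one comes from the
    minimum being attained.\<close>
  obtain s where s: "s \<in> X_opt"
    using assms(5,7) by blast
  have "t = s" if "t \<in> X_opt" for t
    using SSSEP_minimizer_unique[OF strict assms(6)] that s assms(7) by blast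
  with s show "is_singleton X_opt"
    by (intro is_singletonI') auto
qed

end
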